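(* Let $f$ be the function defined for real $x \ge 0$ by $x + f(x) = \min\{p \text{ prime} : p > x\}$. Assume that $c_0 > 0$ is a constant such that $f(x) \le c_0 x^{0.525}$ for every $x \ge 1$. Then there exists a constant $c_0' > 0$ such that for any sequence of radii $r_n$ with $$r_n \ge \frac{1}{2} + \frac{c_0'}{n^{0.475}},$$ there exists $n_0$ such that $\chi(S_{r_n}^{n-1}) > n+1$ for all $n \ge n_0$.
   Context: $S_r^{n-1} = \{x \in \mathbb{R}^n : \|x\|_2 = r\}$ is the Euclidean sphere of radius $r$ in $\mathbb{R}^n$; $\chi(S_r^{n-1})$ is the minimum number of colours needed to colour its points so that any two points at Euclidean distance exactly $1$ receive different colours. *)

theory Defs
  imports
    "HOL-Analysis.Analysis"
    "HOL-Computational_Algebra.Primes"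
    "HOL-Library.Extended_Nat"
begin

text \<open>
  The dimension is a natural number that varies inside the statement, so the space of dimension n
  is the carrier of \<^const>\<open>Euclidean_space\<close>: functions of type \<^typ>\<open>nat \<Rightarrow> real\<close> whose coordinates
  with index at least n vanish. The sphere of radius r in it is the one usually written with the
  exponent n - 1; the first argument below is the dimension n of the ambient space.
\<close>

definition euclid_dist :: "nat \<Rightarrow> (nat \<Rightarrow> real) \<Rightarrow> (nat \<Rightarrow> real) \<Rightarrow> real" where
  "euclid_dist n x y = L2_set (\<lambda>i. x i - y i) {..<n}"

definition euclid_sphere :: "nat \<Rightarrow> real \<Rightarrow> (nat \<Rightarrow> real) set" where
  "euclid_sphere n r = {x \<in> topspace (Euclidean_space n). L2_set x {..<n} = r}"

definition unit_dist_colouring ::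
    "nat \<Rightarrow> (nat \<Rightarrow> real) set \<Rightarrow> nat \<Rightarrow> ((nat \<Rightarrow> real) \<Rightarrow> nat) \<Rightarrow> bool" where
  "unit_dist_colouring n S k c \<longleftrightarrow>
     c ` S \<subseteq> {..<k} \<and> (\<forall>x\<in>S. \<forall>y\<in>S. euclid_dist n x y = 1 \<longrightarrow> c x \<noteq> c y)"

text \<open>
  The infimum of a nonempty set of extended naturals is its minimum; the value is infinite
  when no finite number of colours suffices.
\<close>

definition chromatic_number :: "nat \<Rightarrow> (nat \<Rightarrow> real) set \<Rightarrow> enat" where
  "chromatic_number n S = Inf {enat k |k. \<exists>c. unit_dist_colouring n S k c}"

definition next_prime :: "real \<Rightarrow> nat" where
  "next_prime x = (LEAST p. prime p \<and> real p > x)"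

definition prime_gap :: "real \<Rightarrow> real" where
  "prime_gap x = real (next_prime x) - x"

end

theory Submission
  imports Defs "HOL-Number_Theory.Cong" "HOL-Real_Asymp.Real_Asymp"
begin

text \<open>
  Put m = n - 1 and w = m div 2, and let p be the first prime after m/2 - (1 + c) m^0.525, where c
  is the constant in the prime gap bound; then p is at most m/2 - m^0.525 and 2p > w. The w-subsets
  of an m-set become sign vectors with entries +-1/sqrt(8p), and a constant last coordinate lifts
  them to the sphere of radius r_n, which is possible because m/(8p) is at most the square of r_n.
  Two of them are at distance 1 iff w - |A \<inter> B| = p, which is the only nonzero multiple of p up to w.
  A colour class is therefore a family to which the Frankl--Wilson argument modulo p applies, so it
  has at most the sum of the binomial coefficients (m choose s) with s < p, which is at most
  2^m exp(-m^0.05). Since (m choose w) is at least 2^m/(m + 1), the number of colours is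
  superpolynomial in n.
\<close>

section \<open>The Frankl-Wilson bound by rank modulo a prime\<close>

text \<open>
  The rank bound over the field with p elements, obtained by counting: a coefficient vector c with
  entries below p is determined by the residues of its image under g, so p ^ card F \<le> p ^ card D.
\<close>
lemma card_le_factorization_mod_prime:
  fixes g :: "'a \<Rightarrow> 'b \<Rightarrow> nat" and h :: "'b \<Rightarrow> 'a \<Rightarrow> nat"
  assumes "finite F" "finite D" "prime p"
    and diag: "\<And>A. A \<in> F \<Longrightarrow> \<not> p dvd (\<Sum>S\<in>D. g A S * h S A)"
    and off: "\<And>A B. A \<in> F \<Longrightarrow> B \<in> F \<Longrightarrow> A \<noteq> B \<Longrightarrow> p dvd (\<Sum>S\<in>D. g A S * h S B)"
  shows "card F \<le> card D"
proof -
  define M where "M A B = (\<Sum>S\<in>D. g A S * h S B)" for A B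
  define \<Phi> where "\<Phi> c = (\<lambda>S\<in>D. (\<Sum>A\<in>F. c A * g A S) mod p)" for c :: "'a \<Rightarrow> nat"
  have p1: "p > 1" using \<open>prime p\<close> by (rule prime_gt_1_nat)
  \<comment> \<open>Pairing a combination of rows of \<open>g\<close> with column \<open>B\<close>
    of \<open>h\<close> isolates the coefficient of \<open>B\<close>, since the off-diagonal entries
    of \<open>M\<close> vanish modulo \<open>p\<close>.\<close>
  have comb: "[(\<Sum>S\<in>D. (\<Sum>A\<in>F. c A * g A S) * h S B) = c B * M B B] (mod p)"
    if B: "B \<in> F" for c :: "'a \<Rightarrow> nat" and B
  proof -
    have "(\<Sum>S\<in>D. (\<Sum>A\<in>F. c A * g A S) * h S B) = (\<Sum>A\<in>F. c A * M A B)"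
      unfolding M_def sum_distrib_left sum_distrib_right
      by (subst sum.swap) (simp add: mult.assoc)
    also have "\<dots> = c B * M B B + (\<Sum>A\<in>F-{B}. c A * M A B)"
      using \<open>finite F\<close> B by (simp add: sum.remove)
    also have "[\<dots> = c B * M B B + 0] (mod p)"
      unfolding cong_add_lcancel_nat cong_0_iff
      by (intro dvd_sum dvd_mult) (use off B in \<open>auto simp: M_def\<close>)
    finally show ?thesis by simp
  qed
  have "inj_on \<Phi> (F \<rightarrow>\<^sub>E {..<p})"
  proof (rule inj_onI)
    fix c c' assume c: "c \<in> F \<rightarrow>\<^sub>E {..<p}" "c' \<in> F \<rightarrow>\<^sub>E {..<p}" and eq: "\<Phi> c = \<Phi> c'"
    have *: "[(\<Sum>A\<in>F. c A * g A S) = (\<Sum>A\<in>F. c' A * g A S)] (mod p)" if "S \<in> D" for S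
      using fun_cong[OF eq, of S] that by (simp add: \<Phi>_def cong_def)
    have "c B = c' B" if B: "B \<in> F" for B
    proof -
      have "[(\<Sum>S\<in>D. (\<Sum>A\<in>F. c A * g A S) * h S B) = (\<Sum>S\<in>D. (\<Sum>A\<in>F. c' A * g A S) * h S B)] (mod p)"
        by (intro cong_sum cong_mult * cong_refl)
      with comb[OF B, of c] comb[OF B, of c'] have "[c B * M B B = c' B * M B B] (mod p)"
        by (meson cong_sym cong_trans)
      moreover have "coprime (M B B) p"
        using diag[OF B] \<open>prime p\<close> by (simp add: M_def coprime_commute prime_imp_coprime)
      ultimately have "[c B = c' B] (mod p)"
        by (simp add: cong_mult_rcancel_nat)
      moreover have "c B < p" "c' B < p" using c B by auto
      ultimately show ?thesis by (simp add: cong_def)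
    qed
    then show "c = c'" using c by (intro PiE_ext) auto
  qed
  moreover have "\<Phi> ` (F \<rightarrow>\<^sub>E {..<p}) \<subseteq> D \<rightarrow>\<^sub>E {..<p}"
    using p1 by (auto simp: \<Phi>_def)
  moreover have "finite (D \<rightarrow>\<^sub>E {..<p})"
    using \<open>finite D\<close> by (intro finite_PiE) auto
  ultimately have "card (F \<rightarrow>\<^sub>E {..<p}) \<le> card (D \<rightarrow>\<^sub>E {..<p})"
    by (rule card_inj_on_le)
  then have "p ^ card F \<le> p ^ card D"
    using assms(1,2) by (simp add: card_PiE)
  with p1 show ?thesis by (simp add: power_increasing_iff)
qed

text \<open>Together with the next lemma, this makes \<open>q choose (p - 1)\<close> a test modulo
  \<open>p\<close> for \<open>p dvd Suc q\<close>.\<close>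

lemma prime_dvd_binomial_pred:
  assumes "prime p" "\<not> p dvd Suc q"
  shows "p dvd (q choose (p - 1))"
proof -
  have "p * (Suc q choose p) = Suc q * (q choose (p - 1))"
    using Suc_times_binomial[of "p - 1" q] prime_gt_0_nat[OF assms(1)] by simp
  then have "p dvd Suc q * (q choose (p - 1))"
    by (metis dvd_triv_left)
  then show ?thesis using assms prime_dvd_multD by blast
qed

text \<open>Modulo \<open>p\<close>, row \<open>q\<close> alternates in sign below index
  \<open>p\<close>: there \<open>p\<close> divides \<open>Suc q choose Suc i\<close>, so by Pascal's
  rule neighbouring entries sum to zero, and the row starts with 1.\<close>

lemma prime_not_dvd_binomial_pred:
  assumes "prime p" "p dvd Suc q" "i < p"
  shows "\<not> p dvd (q choose i)"
  using \<open>i < p\<close>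
proof (induction i)
  case 0
  then show ?case using assms(1) by auto
next
  case (Suc i)
  have "Suc i * (Suc q choose Suc i) = Suc q * (q choose i)"
    by (rule Suc_times_binomial)
  then have "p dvd Suc i * (Suc q choose Suc i)"
    using assms(2) by (metis dvd_mult2)
  moreover have "\<not> p dvd Suc i" using Suc.prems by (auto dest: dvd_imp_le)
  ultimately have "p dvd (Suc q choose Suc i)"
    using assms(1) by (blast dest: prime_dvd_multD)
  then have "p dvd (q choose i) + (q choose Suc i)"
    by (simp only: binomial_Suc_Suc)
  then show ?case using Suc by (meson Suc_lessD dvd_add_left_iff)
qed

lemma sum_subsets_by_card:
  fixes f :: "nat \<Rightarrow> nat"
  assumes "finite X"
  shows "(\<Sum>S | S \<subseteq> X \<and> card S < k. f (card S)) = (\<Sum>s<k. (card X choose s) * f s)"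
proof -
  have "(\<Sum>S | S \<subseteq> X \<and> card S < k. f (card S)) 
      = (\<Sum>s<k. \<Sum>S | S \<in> {S. S \<subseteq> X \<and> card S < k} \<and> card S = s. f (card S))"
    by (rule sum.group[symmetric]) (use assms in auto)
  also have "\<dots> = (\<Sum>s<k. (card X choose s) * f s)"
  proof (rule sum.cong)
    fix s assume "s \<in> {..<k}"
    then have "{S. S \<in> {S. S \<subseteq> X \<and> card S < k} \<and> card S = s} = {S. S \<subseteq> X \<and> card S = s}" by auto
    then show "(\<Sum>S | S \<in> {S. S \<subseteq> X \<and> card S < k} \<and> card S = s. f (card S)) = (card X choose s) * f s"
      using n_subsets[OF assms, of s] by simp
  qed simp
  finally show ?thesis .
qed

text \<open>For a suitable \<open>N\<close>, the matrix of values
  \<open>(card (A \<inter> B) + N) choose (p - 1)\<close> is diagonal modulo \<open>p\<close>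
  without zeros on the diagonal, and it factors through the subsets of \<open>X\<close> with fewer
  than \<open>p\<close> elements.\<close>

lemma frankl_wilson_uniform:
  fixes F :: "'a set set"
  assumes "finite X" "prime p"
    and F: "\<And>A. A \<in> F \<Longrightarrow> A \<subseteq> X \<and> card A = w"
    and inter: "\<And>A B. A \<in> F \<Longrightarrow> B \<in> F \<Longrightarrow> A \<noteq> B \<Longrightarrow> \<not> p dvd (w - card (A \<inter> B))"
  shows "card F \<le> (\<Sum>s<p. card X choose s)"
proof -
  have p: "p > 0" using \<open>prime p\<close> by (simp add: prime_gt_0_nat)
  \<comment> \<open>With this N, the value (card (A \<inter> B) + N) choose (p - 1) is nonzero modulo p exactly if
    p divides w - card (A \<inter> B), and Vandermonde's identity factors it through the sets S with
    card S < p.\<close>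
  define N where "N = p * Suc w - Suc w"
  \<comment> \<open>Hence \<open>Suc (card (A \<inter> B) + N)\<close> is congruent to
    \<open>card (A \<inter> B) - w\<close> modulo \<open>p\<close>, while \<open>N\<close> stays a
    natural number.\<close>
  have N: "Suc (w + N) = p * Suc w" using p mult_le_mono1[of 1 p "Suc w"] by (simp add: N_def)
  define D where "D = {S. S \<subseteq> X \<and> card S < p}"
  have finF: "finite F" by (rule finite_subset[of _ "Pow X"]) (use F \<open>finite X\<close> in auto)
  have finD: "finite D" unfolding D_def using \<open>finite X\<close> by auto
  define g where "g A S = of_bool (S \<subseteq> A) * (N choose (p - 1 - card S))" for A S :: "'a set"
  define h :: "'a set \<Rightarrow> 'a set \<Rightarrow> nat" where "h S B = of_bool (S \<subseteq> B)" for S B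
  have val: "(\<Sum>S\<in>D. g A S * h S B) = (card (A \<inter> B) + N) choose (p - 1)"
    if "A \<in> F" for A B
  proof -
    have sub: "A \<inter> B \<subseteq> X" and fin: "finite (A \<inter> B)"
      using F[OF that] \<open>finite X\<close> finite_subset by auto
    have "(\<Sum>S\<in>D. g A S * h S B) = (\<Sum>S | S \<subseteq> A \<inter> B \<and> card S < p. N choose (p - 1 - card S))"
      using sub by (intro sum.mono_neutral_cong_right) (use finD in \<open>auto simp: D_def g_def h_def\<close>)
    also have "\<dots> = (\<Sum>s<p. (card (A \<inter> B) choose s) * (N choose (p - 1 - s)))"
      by (rule sum_subsets_by_card[OF fin])
    also have "{..<p} = {..p - 1}" using p by auto
    finally show ?thesis by (simp only: vandermonde)
  qed
  have "card F \<le> card D"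
  proof (rule card_le_factorization_mod_prime[OF finF finD \<open>prime p\<close>, of g h])
    fix A assume A: "A \<in> F"
    show "\<not> p dvd (\<Sum>S\<in>D. g A S * h S A)"
      unfolding val[OF A] using F[OF A] N p \<open>prime p\<close>
      by (intro prime_not_dvd_binomial_pred) auto
  next
    fix A B assume AB: "A \<in> F" "B \<in> F" "A \<noteq> B"
    have "finite A" using F[OF AB(1)] \<open>finite X\<close> finite_subset by auto
    then have "card (A \<inter> B) \<le> w" using F[OF AB(1)] by (metis Int_lower1 card_mono)
    then have "Suc (card (A \<inter> B) + N) + (w - card (A \<inter> B)) = p * Suc w" using N by simp
    with inter[OF AB] have "\<not> p dvd Suc (card (A \<inter> B) + N)"
      by (metis dvd_add_right_iff dvd_triv_left)
    then show "p dvd (\<Sum>S\<in>D. g A S * h S B)"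
      unfolding val[OF AB(1)] by (rule prime_dvd_binomial_pred[OF \<open>prime p\<close>])
  qed
  also have "card D = (\<Sum>s<p. card X choose s)"
    using sum_subsets_by_card[OF \<open>finite X\<close>, of "\<lambda>_. 1" p] by (simp add: D_def)
  finally show ?thesis .
qed

section \<open>A Chernoff bound for the lower binomial tail\<close>

lemma sum_choose_tail_le:
  fixes t :: real
  assumes "m > 0" "0 \<le> t" "t \<le> m" "real p \<le> m / 2 - t"
  shows "real (\<Sum>s<p. m choose s) \<le> 2 ^ m * exp (- (t\<^sup>2 / m))"
proof -
  \<comment> \<open>The exponential weight parameter: this value minimises the final exponent
    \<open>m * l^2 - 2 * l * t\<close>.\<close>
  define l where "l = t / m"
  have l: "0 \<le> l" "l \<le> 1" using assms by (auto simp: l_def field_simps)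
  have "real (\<Sum>s<p. m choose s) * exp (2 * l * t) = (\<Sum>s<p. (m choose s) * exp (2 * l * t))"
    by (simp add: sum_distrib_right)
  also have "\<dots> \<le> (\<Sum>s<p. (m choose s) * exp (l * (real m - 2 * real s)))"
  proof (intro sum_mono mult_left_mono)
    fix s assume "s \<in> {..<p}"
    then have "2 * t \<le> real m - 2 * real s" using assms(4) by (auto simp: field_simps)
    from mult_left_mono[OF this l(1)] show "exp (2 * l * t) \<le> exp (l * (real m - 2 * real s))"
      by (simp add: algebra_simps)
  qed auto
  also have "\<dots> \<le> (\<Sum>s\<le>m. (m choose s) * exp (l * (real m - 2 * real s)))"
    using assms by (intro sum_mono2) auto
  also have "\<dots> = (\<Sum>s\<le>m. (m choose s) * exp (-l) ^ s * exp l ^ (m - s))"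
    by (intro sum.cong refl) (simp add: exp_of_nat_mult[symmetric] mult.assoc exp_add[symmetric] of_nat_diff algebra_simps)
  also have "\<dots> = (exp (-l) + exp l) ^ m"
    by (simp add: binomial_ring)
  also have "\<dots> \<le> (2 * exp (l\<^sup>2)) ^ m"
  proof (rule power_mono)
    have "exp l \<le> 1 + l + l\<^sup>2" using exp_bound[OF l] .
    moreover have "exp (-l) \<le> 1 - l + l\<^sup>2"
    proof -
      \<comment> \<open>\<open>exp_bound\<close> covers nonnegative arguments, so
        \<open>exp (-l)\<close> is bounded through its inverse. The product here equals
        \<open>1 + l^3\<close>.\<close>
      have "1 \<le> (1 - l + l\<^sup>2) * (1 + l)"
        using l by (simp add: algebra_simps power2_eq_square)
      also have "\<dots> \<le> (1 - l + l\<^sup>2) * exp l"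
        using l exp_ge_add_one_self[of l] by (intro mult_left_mono) auto
      finally show ?thesis by (simp add: exp_minus field_simps)
    qed
    moreover have "1 + l\<^sup>2 \<le> exp (l\<^sup>2)" by (rule exp_ge_add_one_self)
    ultimately show "exp (-l) + exp l \<le> 2 * exp (l\<^sup>2)" by linarith
  qed auto
  also have "\<dots> = 2 ^ m * exp (l * t)"
    using \<open>m > 0\<close> by (simp add: power_mult_distrib exp_of_nat_mult[symmetric] l_def power2_eq_square)
  finally have "real (\<Sum>s<p. m choose s) * exp (2 * l * t) \<le> 2 ^ m * exp (l * t)" .
  then have "real (\<Sum>s<p. m choose s) \<le> 2 ^ m * exp (l * t) / exp (2 * l * t)"
    by (simp add: field_simps)
  also have "\<dots> = 2 ^ m * exp (- (t\<^sup>2 / m))"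
    by (simp add: exp_diff[symmetric] l_def power2_eq_square flip: times_divide_eq_right)
  finally show ?thesis .
qed

section \<open>Embedding uniform set families in the sphere\<close>

text \<open>The height \<open>h\<close> is the same for all sets: it adjusts the radius and cancels
  in distances. The zeros beyond index \<open>m\<close> put the point in
  \<open>Euclidean_space (Suc m)\<close>.\<close>

definition signed_point :: "nat \<Rightarrow> real \<Rightarrow> real \<Rightarrow> nat set \<Rightarrow> nat \<Rightarrow> real" where
  "signed_point m s h A i = (if i < m then (if i \<in> A then s else - s) else if i = m then h else 0)"

lemma signed_point_in_sphere:
  assumes "real m * s\<^sup>2 + h\<^sup>2 = r\<^sup>2" "r \<ge> 0"
  shows "signed_point m s h A \<in> euclid_sphere (Suc m) r"
proof -
  have "(\<Sum>i<m. (signed_point m s h A i)\<^sup>2) = (\<Sum>i<m. s\<^sup>2)"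
    by (intro sum.cong) (auto simp: signed_point_def)
  then have "(\<Sum>i<Suc m. (signed_point m s h A i)\<^sup>2) = r\<^sup>2"
    using assms(1) by (simp add: signed_point_def)
  then have "L2_set (signed_point m s h A) {..<Suc m} = r"
    using assms(2) unfolding L2_set_def by simp
  then show ?thesis
    by (simp add: euclid_sphere_def topspace_Euclidean_space signed_point_def)
qed

lemma dist_signed_point:
  assumes "A \<subseteq> {..<m}" "B \<subseteq> {..<m}" "card A = w" "card B = w"
  shows "euclid_dist (Suc m) (signed_point m s h A) (signed_point m s h B)
         = sqrt (8 * s\<^sup>2 * real (w - card (A \<inter> B)))"
proof -
  have count: "(\<Sum>i<m. of_bool (i \<in> C)) = real (card C)" if "C \<subseteq> {..<m}" for C
    using that by (simp add: sum_of_bool_eq Int_absorb1)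
  have "finite A" using assms(1) finite_subset by blast
  then have le: "card (A \<inter> B) \<le> w" using assms(3) by (metis Int_lower1 card_mono)
  have "(\<Sum>i<m. (signed_point m s h A i - signed_point m s h B i)\<^sup>2)
      = (\<Sum>i<m. 4 * s\<^sup>2 * (of_bool (i \<in> A) + of_bool (i \<in> B) - 2 * of_bool (i \<in> A \<inter> B)))"
    by (intro sum.cong) (auto simp: signed_point_def power2_eq_square)
  also have "\<dots> = 4 * s\<^sup>2 * (real w + real w - 2 * real (card (A \<inter> B)))"
    using assms count[of A] count[of B] count[of "A \<inter> B"]
    by (simp only: sum_distrib_left[symmetric] sum.distrib sum_subtractf) auto
  also have "\<dots> = 8 * s\<^sup>2 * real (w - card (A \<inter> B))"
    using le by (simp add: of_nat_diff algebra_simps)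
  finally show ?thesis
    by (simp add: euclid_dist_def L2_set_def signed_point_def)
qed

text \<open>The \<open>w\<close>-subsets split into \<open>k\<close> colour classes, each of which
  avoids distance 1 and so satisfies the Frankl-Wilson hypothesis.\<close>

lemma binomial_le_colours_mult:
  assumes "prime p" "w < 2 * p" "r \<ge> 0" "real m / (8 * real p) \<le> r\<^sup>2"
    and col: "unit_dist_colouring (Suc m) (euclid_sphere (Suc m) r) k c"
  shows "m choose w \<le> k * (\<Sum>s<p. m choose s)"
proof -
  \<comment> \<open>Chosen so that \<open>8 * s^2 * p = 1\<close>: intersection size
    \<open>w - p\<close> then means distance 1.\<close>
  define s where "s = 1 / sqrt (8 * real p)"
  define h where "h = sqrt (r\<^sup>2 - real m / (8 * real p))"
  have p: "p > 0" using assms(1) by (simp add: prime_gt_0_nat)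
  have s: "s\<^sup>2 = 1 / (8 * real p)" by (simp add: s_def power_divide)
  have "real m * s\<^sup>2 + h\<^sup>2 = r\<^sup>2" using assms(4) by (simp add: s h_def)
  then have sph: "signed_point m s h A \<in> euclid_sphere (Suc m) r" for A
    using assms(3) by (intro signed_point_in_sphere)
  define W where "W = {A. A \<subseteq> {..<m} \<and> card A = w}"
  define colour_class where "colour_class j = {A \<in> W. c (signed_point m s h A) = j}" for j
  have card_colour_class: "card (colour_class j) \<le> (\<Sum>s<p. m choose s)" for j
  proof -
    have "card (colour_class j) \<le> (\<Sum>s<p. card {..<m} choose s)"
    proof (rule frankl_wilson_uniform[OF _ assms(1)])
      fix A B assume A: "A \<in> colour_class j" and B: "B \<in> colour_class j" and "A \<noteq> B"
      have AB: "A \<subseteq> {..<m}" "B \<subseteq> {..<m}" "card A = w" "card B = w"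
        using A B by (auto simp: colour_class_def W_def)
      have fin: "finite A" "finite B" using AB finite_subset by blast+
      have "card (A \<inter> B) < w"
        using \<open>A \<noteq> B\<close> fin AB
        by (metis Int_lower1 Int_lower2 card_subset_eq le_neq_implies_less card_mono)
      show "\<not> p dvd (w - card (A \<inter> B))"
      proof
        assume "p dvd (w - card (A \<inter> B))"
        then obtain q where q: "w - card (A \<inter> B) = p * q" by (elim dvdE)
        with \<open>card (A \<inter> B) < w\<close> \<open>w < 2 * p\<close> have "0 < p * q" "p * q < p * 2" by linarith+
        then have "q = 1" by simp
        then have "euclid_dist (Suc m) (signed_point m s h A) (signed_point m s h B) = 1"
          using p by (simp add: dist_signed_point[OF AB] q s)
        then have "c (signed_point m s h A) \<noteq> c (signed_point m s h B)"
          using col sph unfolding unit_dist_colouring_def by blast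
        then show False using A B by (simp add: colour_class_def)
      qed
    qed (auto simp: colour_class_def W_def)
    then show ?thesis by simp
  qed
  have "W = (\<Union>j<k. colour_class j)"
    using col sph unfolding unit_dist_colouring_def colour_class_def by auto
  then have "card W \<le> (\<Sum>j<k. card (colour_class j))" by (metis card_UN_le finite_lessThan)
  also have "\<dots> \<le> (\<Sum>j<k. \<Sum>s<p. m choose s)" by (intro sum_mono card_colour_class)
  finally show ?thesis
    using n_subsets[of "{..<m}" w] by (simp add: W_def)
qed

section \<open>From the counting bound to the chromatic number\<close>

lemma next_prime: "prime (next_prime x)" "real (next_prime x) > x"
proof -
  obtain p where "prime p" "p > nat \<lceil>x\<rceil>" using bigger_prime by blast
  then have "prime p \<and> real p > x" by linarith
  then have "prime (next_prime x) \<and> real (next_prime x) > x"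
    unfolding next_prime_def by (rule LeastI)
  then show "prime (next_prime x)" "real (next_prime x) > x" by auto
qed

lemma two_power_le_middle_binomial: "2 ^ m \<le> Suc m * (m choose (m div 2))"
proof -
  have "(2::nat) ^ m = (\<Sum>k\<le>m. m choose k)" by (simp add: choose_row_sum)
  also have "\<dots> \<le> (\<Sum>k\<le>m. m choose (m div 2))" by (intro sum_mono binomial_maximum)
  finally show ?thesis by simp
qed

text \<open>The factor \<open>2 ^ m\<close> cancels between the middle binomial coefficient and the
  tail bound, at the cost of \<open>Suc m\<close>.\<close>

lemma colours_ge_exp:
  fixes t :: real
  assumes "prime p" "m div 2 < 2 * p" "0 \<le> t" "real p \<le> m / 2 - t"
    and "r \<ge> 0" "real m / (8 * real p) \<le> r\<^sup>2"
    and "unit_dist_colouring (Suc m) (euclid_sphere (Suc m) r) k c"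
  shows "exp (t\<^sup>2 / m) \<le> real (Suc m) * real k"
proof -
  have "m > 0" "t \<le> m"
    using assms(3,4) prime_gt_0_nat[OF assms(1)] by (auto intro: gr0I)
  have "2 ^ m \<le> Suc m * (m choose (m div 2))" by (rule two_power_le_middle_binomial)
  also have "\<dots> \<le> Suc m * (k * (\<Sum>s<p. m choose s))"
    by (intro mult_le_mono2 binomial_le_colours_mult[OF assms(1,2,5-7)])
  finally have "real (2 ^ m) \<le> real (Suc m * (k * (\<Sum>s<p. m choose s)))"
    unfolding of_nat_le_iff .
  then have "2 ^ m \<le> real (Suc m) * real k * real (\<Sum>s<p. m choose s)"
    by (simp only: of_nat_mult of_nat_power of_nat_numeral mult.assoc)
  also have "\<dots> \<le> real (Suc m) * real k * (2 ^ m * exp (- (t\<^sup>2 / m)))"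
    using sum_choose_tail_le[OF \<open>m > 0\<close> assms(3) \<open>t \<le> m\<close> assms(4)] by (intro mult_left_mono) auto
  finally have "1 \<le> real (Suc m) * real k * exp (- (t\<^sup>2 / m))"
    by (simp add: mult.left_commute[of _ "2 ^ m"])
  then show ?thesis by (simp add: exp_minus field_simps)
qed

text \<open>If no finite number of colours suffices, the infimum is infinite; otherwise it is
  attained, as \<open>enat\<close> is well-ordered.\<close>

lemma chromatic_number_greater:
  assumes "\<And>k c. unit_dist_colouring n S k c \<Longrightarrow> N < k"
  shows "chromatic_number n S > enat N"
proof (rule ccontr)
  define K where "K = {enat k |k. \<exists>c. unit_dist_colouring n S k c}"
  assume "\<not> ?thesis"
  then have le: "Inf K \<le> enat N" by (simp add: chromatic_number_def K_def)
  have "K \<noteq> {}"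
  proof
    assume "K = {}"
    with le have "(top::enat) \<le> enat N" by (simp only: Inf_empty)
    then show False by (simp add: top_enat_def)
  qed
  then have "Inf K \<in> K" using wellorder_InfI by blast
  moreover have "\<exists>k c. e = enat k \<and> unit_dist_colouring n S k c" if "e \<in> K" for e
    using that unfolding K_def by blast
  ultimately obtain k c where "Inf K = enat k" "unit_dist_colouring n S k c" by blast
  with le assms[of k c] show False by simp
qed

theorem theorem6:
  fixes c\<^sub>0 :: real
  assumes "c\<^sub>0 > 0"
    and "\<And>x::real. x \<ge> 1 \<Longrightarrow> prime_gap x \<le> c\<^sub>0 * x powr 0.525"
  shows "\<exists>c\<^sub>0'>0. \<forall>r :: nat \<Rightarrow> real.
           (\<forall>n\<ge>1. r n \<ge> 1/2 + c\<^sub>0' / real n powr 0.475) \<longrightarrow>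
           (\<exists>n\<^sub>0. \<forall>n\<ge>n\<^sub>0. chromatic_number n (euclid_sphere n (r n)) > enat (n + 1))"
proof -
  \<comment> \<open>The summand \<open>c\<^sub>0\<close> absorbs the prime gap; the summand 1 leaves
    the margin \<open>m powr 0.525\<close> that enters the tail bound as \<open>t\<close>.\<close>
  define a where "a = 1 + c\<^sub>0"
  have "a > 0" using assms(1) by (simp add: a_def)
  show ?thesis
  proof (intro exI[of _ a] conjI allI impI)
    show "a > 0" by fact
  next
    fix r :: "nat \<Rightarrow> real"
    assume r: "\<forall>n\<ge>1. r n \<ge> 1/2 + a / real n powr 0.475"
    define x where "x m = real m / 2 - a * real m powr 0.525" for m :: nat
    have "eventually (\<lambda>m. x m \<ge> 1) sequentially"
      using \<open>a > 0\<close> unfolding x_def by real_asymp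
    moreover have "eventually (\<lambda>m. real m / 2 < 2 * x m) sequentially"
      using \<open>a > 0\<close> unfolding x_def by real_asymp
    \<comment> \<open>The left side is 1/4 plus \<open>(a / 2) * m powr (-0.475)\<close> up to lower
      order, so the coefficient \<open>a\<close> leaves room.\<close>
    moreover have "eventually (\<lambda>m. real m / (8 * x m) \<le> 1/4 + a / real (Suc m) powr 0.475) sequentially"
      using \<open>a > 0\<close> unfolding x_def by real_asymp
    \<comment> \<open>The exponent is \<open>m powr 0.05\<close>, so the exponential outgrows every
      polynomial.\<close>
    moreover have "eventually (\<lambda>m. exp ((real m powr 0.525)\<^sup>2 / real m) > real (Suc m) * real (Suc m + 1)) sequentially"
      by real_asymp
    ultimately have "eventually (\<lambda>m. chromatic_number (Suc m) (euclid_sphere (Suc m) (r (Suc m))) > enat (Suc m + 1)) sequentially"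
    proof eventually_elim
      case (elim m)
      define p where "p = next_prime (x m)"
      define \<delta> where "\<delta> = a / real (Suc m) powr 0.475"
      have p: "prime p" "x m < p" using next_prime unfolding p_def by auto
      have "x m \<le> real m"
      proof -
        have "0 \<le> a * real m powr 0.525" using \<open>a > 0\<close> by simp
        then show ?thesis unfolding x_def by linarith
      qed
      have "p \<le> x m + c\<^sub>0 * x m powr 0.525"
        using assms(2)[OF elim(1)] by (simp add: prime_gap_def p_def)
      also have "\<dots> \<le> x m + c\<^sub>0 * real m powr 0.525"
        using assms(1) elim(1) \<open>x m \<le> real m\<close> by (intro add_left_mono mult_left_mono powr_mono2) auto
      finally have p_le: "p \<le> real m / 2 - real m powr 0.525"
        by (simp add: x_def a_def algebra_simps)
      have "m div 2 < 2 * p" using elim(2) p(2) by linarith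
      have "\<delta> \<ge> 0" using \<open>a > 0\<close> by (simp add: \<delta>_def)
      have r': "r (Suc m) \<ge> 1/2 + \<delta>" using r[rule_format, of "Suc m"] by (simp add: \<delta>_def)
      have "real m / (8 * real p) \<le> real m / (8 * x m)"
        using p(2) elim(1) by (intro divide_left_mono) auto
      also have "\<dots> \<le> 1/4 + \<delta>" using elim(3) by (simp add: \<delta>_def)
      also have "\<dots> \<le> (1/2 + \<delta>)\<^sup>2" using \<open>\<delta> \<ge> 0\<close> by (simp add: power2_eq_square algebra_simps)
      also have "\<dots> \<le> (r (Suc m))\<^sup>2" using r' \<open>\<delta> \<ge> 0\<close> by (intro power_mono) auto
      finally have rad: "real m / (8 * real p) \<le> (r (Suc m))\<^sup>2" .
      show ?case
      proof (rule chromatic_number_greater)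
        fix k c assume col: "unit_dist_colouring (Suc m) (euclid_sphere (Suc m) (r (Suc m))) k c"
        have "r (Suc m) \<ge> 0" using r' \<open>\<delta> \<ge> 0\<close> by linarith
        from colours_ge_exp[OF p(1) \<open>m div 2 < 2 * p\<close> powr_ge_zero p_le this rad col]
        have "exp ((real m powr 0.525)\<^sup>2 / m) \<le> real (Suc m) * real k" .
        with elim(4) have "real (Suc m) * real (Suc m + 1) < real (Suc m) * real k" by linarith
        then show "Suc m + 1 < k" by (simp only: mult_less_cancel_left_pos of_nat_0_less_iff zero_less_Suc of_nat_less_iff)
      qed
    qed
    then have "eventually (\<lambda>n. chromatic_number n (euclid_sphere n (r n)) > enat (n + 1)) sequentially"
      by (subst (asm) eventually_sequentially_Suc)
    then show "\<exists>n\<^sub>0. \<forall>n\<ge>n\<^sub>0. chromatic_number n (euclid_sphere n (r n)) > enat (n + 1)"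
      by (simp only: eventually_sequentially)
  qed
qed

end
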